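(* Let $P$ be the Markov kernel of an irreducible finite Markov chain on $\mathcal X$ with stationary distribution $\pi$. If $|\mathcal C^c|<\infty$ and $P$ admits a MH-spectral gap, i.e. $\gamma^{MH}>0$, then for $\epsilon\in(0,1)$ $$t_{mix}(\epsilon)\le t^*+\frac{\log\left(\frac1{\epsilon\,\pi_{min}}\right)}{\gamma^{MH}},$$ where $t^*:=\max_{n\in\mathcal C^c}n$ (with $t^*=0$ if $\mathcal C^c=\emptyset$) and $\pi_{min}:=\min_x\pi(x)$.
   Context: Mixing time: $d(n)=\sup_{x\in\mathcal X}\|P^n(x,\cdot)-\pi\|_{TV}$ with $\|\nu_1-\nu_2\|_{TV}=\sup_A|\nu_1(A)-\nu_2(A)|$, and $t_{mix}(\epsilon)=\min\{n:d(n)\le\epsilon\}$. For a stochastic matrix $R$ on $\mathcal X$ with stationary distribution $\pi$, $R^*(x,y)=\pi(y)R(y,x)/\pi(x)$. The first and second Metropolis-Hastings (MH) kernels of $R$ are given for $x\ne y$ by $M_1(R)(x,y)=\min\{R(x,y),R^*(x,y)\}$, $M_2(R)(x,y)=\max\{R(x,y),R^*(x,y)\}$, and on the diagonal by $M_1(R)(x,x)=R(x,x)+\rho_R(x)$, $M_2(R)(x,x)=R(x,x)-\rho_R(x)$, where $\rho_R(x)=\sum_{y\ne x}(R(x,y)-\min\{R(x,y),R^*(x,y)\})$. They are self-adjoint on $L^2(\pi)$. For self-adjoint $K$ with $\pi K=\pi$: $\lambda(K)=\inf\langle Kf,f\rangle_\pi$ and $\Lambda(K)=\sup\langle Kf,f\rangle_\pi$,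 both over $f$ with $\sum_x f(x)\pi(x)=0$ and $\|f\|_\pi=1$. MH-spectral gap: $\mathcal C:=\{n\in\mathbb N:|\lambda(M_2(P^n))|<1,\ \Lambda(M_1(P^n))<1\}$, $\mathcal C^c:=\mathbb N\setminus\mathcal C$; $\beta^{MH}:=1$ if $\mathcal C=\emptyset$, and otherwise $\beta^{MH}:=\sup_{n\in\mathcal C}\{|\lambda(M_2(P^n))|^{1/n},\Lambda(M_1(P^n))^{1/n}\}$ (supremum of both families; terms with $\Lambda(M_1(P^n))<0$ are omitted); $\gamma^{MH}:=1-\beta^{MH}$. *)

theory Defs
  imports "HOL-Analysis.Analysis"
begin

text \<open>
  The finite state space is a type \<open>'a\<close> of class \<open>finite\<close>; kernels are matrices
  \<open>K $ x $ y\<close>, measures and functions are vectors.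
\<close>

definition prob_vec :: "real^'a \<Rightarrow> bool" where
  "prob_vec \<nu> \<longleftrightarrow> (\<forall>x. 0 \<le> \<nu> $ x) \<and> (\<Sum>x\<in>UNIV. \<nu> $ x) = 1"

definition stochastic :: "real^'a^'a \<Rightarrow> bool" where
  "stochastic P \<longleftrightarrow> (\<forall>x. prob_vec (P $ x))"

text \<open>Matrix power; the class operation \<open>^\<close> on vectors would be taken entrywise.\<close>

definition kpow :: "real^'a^'a \<Rightarrow> nat \<Rightarrow> real^'a^'a" where
  "kpow P n = (((**) P) ^^ n) (mat 1)"

definition irreducible_kernel :: "real^'a^'a \<Rightarrow> bool" where
  "irreducible_kernel P \<longleftrightarrow> (\<forall>x y. \<exists>n. kpow P n $ x $ y > 0)"

definition stationary :: "real^'a^'a \<Rightarrow> real^'a \<Rightarrow> bool" where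
  "stationary P \<pi> \<longleftrightarrow> prob_vec \<pi> \<and> \<pi> v* P = \<pi>"

definition tv_dist :: "real^'a \<Rightarrow> real^'a \<Rightarrow> real" where
  "tv_dist \<nu>\<^sub>1 \<nu>\<^sub>2 = (SUP A. \<bar>(\<Sum>y\<in>A. \<nu>\<^sub>1 $ y) - (\<Sum>y\<in>A. \<nu>\<^sub>2 $ y)\<bar>)"

definition mix_dist :: "real^'a^'a \<Rightarrow> real^'a \<Rightarrow> nat \<Rightarrow> real" where
  "mix_dist P \<pi> n = (SUP x. tv_dist (kpow P n $ x) \<pi>)"

text \<open>
  The mixing time is an extended natural number, so that it is \<open>\<infinity>\<close> when no \<open>n\<close> satisfies
  \<open>d(n) \<le> \<epsilon>\<close>; otherwise the infimum is the minimum.  Time \<open>0\<close> is allowed.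
\<close>

definition t_mix :: "real^'a^'a \<Rightarrow> real^'a \<Rightarrow> real \<Rightarrow> enat" where
  "t_mix P \<pi> \<epsilon> = (INF n\<in>{n. mix_dist P \<pi> n \<le> \<epsilon>}. enat n)"

definition time_reversal :: "real^'a \<Rightarrow> real^'a^'a \<Rightarrow> real^'a^'a" where
  "time_reversal \<pi> R = (\<chi> x y. \<pi> $ y * R $ y $ x / \<pi> $ x)"

definition MH_rho :: "real^'a \<Rightarrow> real^'a^'a \<Rightarrow> 'a \<Rightarrow> real" where
  "MH_rho \<pi> R x = (\<Sum>y\<in>UNIV - {x}. R $ x $ y - min (R $ x $ y) (time_reversal \<pi> R $ x $ y))"

definition MH1 :: "real^'a \<Rightarrow> real^'a^'a \<Rightarrow> real^'a^'a" where
  "MH1 \<pi> R = (\<chi> x y. if x = y then R $ x $ x + MH_rho \<pi> R x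
                      else min (R $ x $ y) (time_reversal \<pi> R $ x $ y))"

definition MH2 :: "real^'a \<Rightarrow> real^'a^'a \<Rightarrow> real^'a^'a" where
  "MH2 \<pi> R = (\<chi> x y. if x = y then R $ x $ x - MH_rho \<pi> R x
                      else max (R $ x $ y) (time_reversal \<pi> R $ x $ y))"

definition inner_pi :: "real^'a \<Rightarrow> real^'a \<Rightarrow> real^'a \<Rightarrow> real" where
  "inner_pi \<pi> f g = (\<Sum>x\<in>UNIV. f $ x * g $ x * \<pi> $ x)"

definition norm_pi :: "real^'a \<Rightarrow> real^'a \<Rightarrow> real" where
  "norm_pi \<pi> f = sqrt (inner_pi \<pi> f f)"

text \<open>
  On a one-point space there is no admissible test function, and \<open>lambda_inf\<close>, \<open>lambda_sup\<close>
  are then unspecified reals.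
\<close>

definition test_functions :: "real^'a \<Rightarrow> (real^'a) set" where
  "test_functions \<pi> = {f. (\<Sum>x\<in>UNIV. f $ x * \<pi> $ x) = 0 \<and> norm_pi \<pi> f = 1}"

definition lambda_inf :: "real^'a \<Rightarrow> real^'a^'a \<Rightarrow> real" where
  "lambda_inf \<pi> K = (INF f\<in>test_functions \<pi>. inner_pi \<pi> (K *v f) f)"

definition lambda_sup :: "real^'a \<Rightarrow> real^'a^'a \<Rightarrow> real" where
  "lambda_sup \<pi> K = (SUP f\<in>test_functions \<pi>. inner_pi \<pi> (K *v f) f)"

text \<open>Here the natural numbers start at \<open>1\<close>, as the exponents \<open>1/n\<close> require.\<close>

definition MH_C :: "real^'a^'a \<Rightarrow> real^'a \<Rightarrow> nat set" where
  "MH_C P \<pi> = {n. n \<ge> 1 \<and> \<bar>lambda_inf \<pi> (MH2 \<pi> (kpow P n))\<bar> < 1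
                        \<and> lambda_sup \<pi> (MH1 \<pi> (kpow P n)) < 1}"

definition MH_Cc :: "real^'a^'a \<Rightarrow> real^'a \<Rightarrow> nat set" where
  "MH_Cc P \<pi> = {1..} - MH_C P \<pi>"

definition MH_beta :: "real^'a^'a \<Rightarrow> real^'a \<Rightarrow> real" where
  "MH_beta P \<pi> =
     (if MH_C P \<pi> = {} then 1
      else Sup ({root n \<bar>lambda_inf \<pi> (MH2 \<pi> (kpow P n))\<bar> | n. n \<in> MH_C P \<pi>}
              \<union> {root n (lambda_sup \<pi> (MH1 \<pi> (kpow P n))) | n.
                   n \<in> MH_C P \<pi> \<and> 0 \<le> lambda_sup \<pi> (MH1 \<pi> (kpow P n))}))"

definition MH_gap :: "real^'a^'a \<Rightarrow> real^'a \<Rightarrow> real" where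
  "MH_gap P \<pi> = 1 - MH_beta P \<pi>"

definition t_star :: "real^'a^'a \<Rightarrow> real^'a \<Rightarrow> nat" where
  "t_star P \<pi> = (if MH_Cc P \<pi> = {} then 0 else Max (MH_Cc P \<pi>))"

definition pi_min :: "real^'a \<Rightarrow> real" where
  "pi_min \<pi> = Min (range (\<lambda>x. \<pi> $ x))"

end

theory Submission
  imports Defs
begin

text \<open>
  Write \<open>R = P\<^sup>n\<close> and \<open>b = \<beta>\<^sup>n\<close> with \<open>n > t\<^sup>*\<close>, so that \<open>n\<close> lies in \<open>\<C>\<close>. The kernel \<open>R\<close> is not
  self-adjoint, and bounds on its real quadratic form say nothing about its antisymmetric part.
  The two Metropolis-Hastings kernels avoid this difficulty: they are self-adjoint, and entry by
  entry \<open>R\<close> lies between them.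

  Off the diagonal \<open>M\<^sub>1(R) \<le> M\<^sub>2(R)\<close>, hence the Dirichlet form of \<open>M\<^sub>1(R)\<close> is the smaller one and
  \<open>\<langle>M\<^sub>2 f, f\<rangle> \<le> \<langle>M\<^sub>1 f, f\<rangle>\<close> (\<open>quadratic_form_antimono\<close>). The lower bound \<open>-b\<close> for
  \<open>M\<^sub>2\<close> and the upper bound \<open>b\<close> for \<open>M\<^sub>1\<close>, which the gap supplies, therefore
  hold for both kernels (\<open>MH_forms_bounded\<close>). For a self-adjoint operator such a two-sided
  bound is a bound \<open>b\<close> on the operator norm over the mean-zero functions
  (\<open>reversible_contraction\<close>). Applied to the centred density of a point mass, it
  controls the chi-square divergence of every row of \<open>M\<^sub>1\<close> and \<open>M\<^sub>2\<close> from \<open>\<pi>\<close>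
  (\<open>reversible_chi_square_le\<close>). As \<open>R\<close> lies between the two, its rows have chi-square
  divergence at most \<open>2 b\<^sup>2 (1/\<pi>(x) - 1)\<close> (\<open>chi_square_le_MH_sum\<close>), and Cauchy-Schwarz passes
  to total variation (\<open>tv_dist_le_chi_square\<close>).

  It remains to round the time to an integer without losing anything. Put
  \<open>L = ln (1/(\<epsilon> \<pi>\<^sub>m\<^sub>i\<^sub>n))\<close> and \<open>n = t\<^sup>* + \<lfloor>L/\<gamma>\<rfloor>\<close>. If \<open>L/\<gamma> \<ge> 1\<close>, then rounding down costs a factor
  \<open>e\<^sup>\<gamma> \<le> e\<close> in \<open>b\<close>, and this is absorbed since the chi-square route has a margin of
  \<open>2 \<surd>2 > e\<close> over \<open>b/\<pi>\<^sub>m\<^sub>i\<^sub>n\<close>. If \<open>L/\<gamma> < 1\<close>, then \<open>\<epsilon> \<pi>\<^sub>m\<^sub>i\<^sub>n > 1/e\<close>, and the trivial bound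
  \<open>1 - \<pi>\<^sub>m\<^sub>i\<^sub>n\<close> on total variation is already at most \<open>\<epsilon>\<close>.
\<close>

section \<open>Markov kernels and total variation\<close>

lemma stochastic_kpow:
  fixes P :: "real^'a^'a"
  assumes "stochastic P"
  shows "stochastic (kpow P n)"
proof (induction n)
  case 0
  show ?case
    by (auto simp: kpow_def stochastic_def prob_vec_def mat_def)
next
  case (Suc n)
  let ?Q = "kpow P n"
  have entry: "kpow P (Suc n) $ x $ y = (\<Sum>k\<in>UNIV. P $ x $ k * ?Q $ k $ y)" for x y
    by (simp add: kpow_def matrix_matrix_mult_def)
  have "(\<Sum>y\<in>UNIV. kpow P (Suc n) $ x $ y) = 1" for x
  proof -
    have "(\<Sum>y\<in>UNIV. kpow P (Suc n) $ x $ y) = (\<Sum>k\<in>UNIV. \<Sum>y\<in>UNIV. P $ x $ k * ?Q $ k $ y)"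
      unfolding entry by (rule sum.swap)
    also have "\<dots> = (\<Sum>k\<in>UNIV. P $ x $ k)"
      using Suc by (simp add: sum_distrib_left[symmetric] stochastic_def prob_vec_def)
    finally show ?thesis
      using assms by (simp add: stochastic_def prob_vec_def)
  qed
  moreover have "0 \<le> kpow P (Suc n) $ x $ y" for x y
    unfolding entry using assms Suc
    by (intro sum_nonneg mult_nonneg_nonneg) (auto simp: stochastic_def prob_vec_def)
  ultimately show ?case
    by (simp add: stochastic_def prob_vec_def)
qed

lemma stationary_kpow:
  fixes P :: "real^'a^'a"
  assumes "stationary P \<pi>"
  shows "stationary (kpow P n) \<pi>"
proof -
  have "\<pi> v* kpow P n = \<pi>"
  proof (induction n)
    case (Suc n)
    have "\<pi> v* kpow P (Suc n) = (\<pi> v* P) v* kpow P n"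
      by (simp add: kpow_def vector_matrix_mul_assoc)
    then show ?case
      using Suc assms by (simp add: stationary_def)
  qed (simp add: kpow_def)
  then show ?thesis
    using assms by (simp add: stationary_def)
qed

lemma stationary_entry:
  fixes R :: "real^'a^'a"
  assumes "stationary R \<pi>"
  shows "(\<Sum>x\<in>UNIV. \<pi> $ x * R $ x $ y) = \<pi> $ y"
proof -
  have "(\<pi> v* R) $ y = \<pi> $ y"
    using assms by (simp add: stationary_def)
  then show ?thesis
    by (simp add: vector_matrix_mult_def mult.commute)
qed

text \<open>
  Some point carries mass, and irreducibility transports part of it to every other point in some
  number of steps, under which \<open>\<pi>\<close> does not change.
\<close>

lemma irreducible_stationary_pos:
  fixes P :: "real^'a^'a"
  assumes "stochastic P" "irreducible_kernel P" "stationary P \<pi>"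
  shows "\<pi> $ y > 0"
proof -
  have nn: "0 \<le> \<pi> $ x" and tot: "(\<Sum>x\<in>UNIV. \<pi> $ x) = 1" for x
    using assms(3) by (auto simp: stationary_def prob_vec_def)
  obtain x where "\<pi> $ x \<noteq> 0"
    using tot by (metis sum.neutral zero_neq_one)
  with nn have x: "\<pi> $ x > 0"
    by (simp add: order_less_le)
  obtain n where n: "kpow P n $ x $ y > 0"
    using assms(2) by (auto simp: irreducible_kernel_def)
  have "0 < (\<Sum>z\<in>UNIV. \<pi> $ z * kpow P n $ z $ y)"
  proof (rule sum_pos2)
    show "0 < \<pi> $ x * kpow P n $ x $ y"
      using x n by simp
    show "0 \<le> \<pi> $ z * kpow P n $ z $ y" for z
      using nn stochastic_kpow[OF assms(1), of n] by (simp add: stochastic_def prob_vec_def)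
  qed auto
  then show ?thesis
    by (simp add: stationary_entry[OF stationary_kpow[OF assms(3)]])
qed

text \<open>
  Two probability vectors cannot have \<open>\<nu> < \<pi>\<close> everywhere. At a point \<open>y\<close> with \<open>\<pi>(y) \<le> \<nu>(y)\<close> they
  share the mass \<open>\<pi>(y)\<close>, which cannot contribute to any difference \<open>\<bar>\<nu>(A) - \<pi>(A)\<bar>\<close>.
\<close>

lemma tv_dist_le_one_minus:
  assumes "prob_vec \<nu>" "prob_vec \<pi>" and m: "\<And>x. m \<le> \<pi> $ x"
  shows "tv_dist \<nu> \<pi> \<le> 1 - m"
  unfolding tv_dist_def
proof (rule cSUP_least)
  fix A :: "'a set"
  have nn: "0 \<le> \<nu> $ x" "0 \<le> \<pi> $ x" for x
    using assms by (auto simp: prob_vec_def)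
  have tot: "(\<Sum>x\<in>UNIV. \<nu> $ x) = 1" "(\<Sum>x\<in>UNIV. \<pi> $ x) = 1"
    using assms by (auto simp: prob_vec_def)
  obtain y where y: "\<pi> $ y \<le> \<nu> $ y"
  proof (rule ccontr)
    assume "\<not> thesis"
    then have "\<forall>y. \<nu> $ y < \<pi> $ y"
      using that by (meson not_le)
    then have "(\<Sum>x\<in>UNIV. \<nu> $ x) < (\<Sum>x\<in>UNIV. \<pi> $ x)"
      by (intro sum_strict_mono) auto
    then show False
      using tot by simp
  qed
  have le1: "sum (($) \<mu>) A \<le> 1" "0 \<le> sum (($) \<mu>) A"
      "y \<in> A \<Longrightarrow> \<mu> $ y \<le> sum (($) \<mu>) A" "y \<notin> A \<Longrightarrow> sum (($) \<mu>) A \<le> 1 - \<mu> $ y"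
    if "prob_vec \<mu>" for \<mu> :: "real^'a"
  proof -
    have nn': "0 \<le> \<mu> $ x" for x
      using that by (auto simp: prob_vec_def)
    have tot': "sum (($) \<mu>) UNIV = 1"
      using that by (auto simp: prob_vec_def)
    show "sum (($) \<mu>) A \<le> 1"
      using sum_mono2[of UNIV A "($) \<mu>"] nn' tot' by simp
    show "0 \<le> sum (($) \<mu>) A"
      by (intro sum_nonneg nn')
    show "y \<in> A \<Longrightarrow> \<mu> $ y \<le> sum (($) \<mu>) A"
      using member_le_sum[of y A "($) \<mu>"] nn' by simp
    assume "y \<notin> A"
    then have "sum (($) \<mu>) A + \<mu> $ y = sum (($) \<mu>) (insert y A)"
      by simp
    also have "\<dots> \<le> 1"
      using sum_mono2[of UNIV "insert y A" "($) \<mu>"] nn' tot' by simp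
    finally show "sum (($) \<mu>) A \<le> 1 - \<mu> $ y"
      by simp
  qed
  show "\<bar>(\<Sum>x\<in>A. \<nu> $ x) - (\<Sum>x\<in>A. \<pi> $ x)\<bar> \<le> 1 - m"
    using le1[OF assms(1)] le1[OF assms(2)] y m[of y] by (cases "y \<in> A") (auto simp: abs_le_iff)
qed simp

text \<open>
  The chi-square divergence, that is, the squared \<open>L\<^sup>2(\<pi>)\<close>-norm of \<open>\<nu>/\<pi> - 1\<close>.
\<close>

definition chi_square :: "real^'a \<Rightarrow> real^'a \<Rightarrow> real" where
  "chi_square \<nu> \<pi> = (\<Sum>y\<in>UNIV. (\<nu> $ y - \<pi> $ y)\<^sup>2 / \<pi> $ y)"

text \<open>
  The signed mass \<open>\<nu> - \<pi>\<close> sums to zero, so a set and its complement see the same discrepancy; the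
  factor \<open>1/2\<close> comes from this. Cauchy-Schwarz against the weights \<open>\<pi>\<close> does the rest.
\<close>

lemma tv_dist_le_chi_square:
  assumes "prob_vec \<nu>" "prob_vec \<pi>" "\<And>x. 0 < \<pi> $ x"
    and "chi_square \<nu> \<pi> \<le> (2 * c)\<^sup>2" "0 \<le> c"
  shows "tv_dist \<nu> \<pi> \<le> c"
  unfolding tv_dist_def
proof (rule cSUP_least)
  fix A :: "'a set"
  define d where "d y = \<nu> $ y - \<pi> $ y" for y
  have "(\<Sum>y\<in>UNIV. \<bar>d y\<bar>) = (\<Sum>y\<in>UNIV. (\<bar>d y\<bar> / sqrt (\<pi> $ y)) * sqrt (\<pi> $ y))"
    using assms(3) by (intro sum.cong) (auto simp: less_imp_neq[symmetric])
  then have "(\<Sum>y\<in>UNIV. \<bar>d y\<bar>)\<^sup>2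
      \<le> (\<Sum>y\<in>UNIV. (\<bar>d y\<bar> / sqrt (\<pi> $ y))\<^sup>2) * (\<Sum>y\<in>UNIV. (sqrt (\<pi> $ y))\<^sup>2)"
    using Cauchy_Schwarz_ineq_sum[of "\<lambda>y. \<bar>d y\<bar> / sqrt (\<pi> $ y)" "\<lambda>y. sqrt (\<pi> $ y)" UNIV] by simp
  also have "(\<Sum>y\<in>UNIV. (sqrt (\<pi> $ y))\<^sup>2) = 1"
    using assms(2,3) by (simp add: prob_vec_def less_imp_le)
  also have "(\<Sum>y\<in>UNIV. (\<bar>d y\<bar> / sqrt (\<pi> $ y))\<^sup>2) = chi_square \<nu> \<pi>"
    using assms(3) by (simp add: chi_square_def power_divide d_def less_imp_le)
  finally have "(\<Sum>y\<in>UNIV. \<bar>d y\<bar>)\<^sup>2 \<le> (2 * c)\<^sup>2"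
    using assms(4) by simp
  then have l1: "(\<Sum>y\<in>UNIV. \<bar>d y\<bar>) \<le> 2 * c"
    using assms(5) by (simp add: power2_le_imp_le[of _ "2 * c"])
  have "sum d UNIV = 0"
    using assms(1,2) by (simp add: d_def sum_subtractf prob_vec_def)
  then have compl: "sum d A = - sum d (- A)"
    using sum.subset_diff[of A UNIV d] by (simp add: Compl_eq_Diff_UNIV)
  have "2 * \<bar>sum d A\<bar> = \<bar>sum d A\<bar> + \<bar>sum d (- A)\<bar>"
    using compl by simp
  also have "\<dots> \<le> (\<Sum>y\<in>A. \<bar>d y\<bar>) + (\<Sum>y\<in>-A. \<bar>d y\<bar>)"
    by (intro add_mono sum_abs)
  also have "\<dots> = (\<Sum>y\<in>UNIV. \<bar>d y\<bar>)"
    using sum.subset_diff[of A UNIV "\<lambda>y. \<bar>d y\<bar>"] by (simp add: Compl_eq_Diff_UNIV)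
  finally show "\<bar>(\<Sum>y\<in>A. \<nu> $ y) - (\<Sum>y\<in>A. \<pi> $ y)\<bar> \<le> c"
    using l1 by (simp add: d_def sum_subtractf)
qed simp

section \<open>Reversible kernels\<close>

text \<open>
  Entries may be negative: \<open>MH2\<close> is reversible with unit row sums, but its diagonal can be
  below zero.
\<close>

definition reversible_kernel :: "real^'a \<Rightarrow> real^'a^'a \<Rightarrow> bool" where
  "reversible_kernel \<pi> K \<longleftrightarrow>
     (\<forall>x y. \<pi> $ x * K $ x $ y = \<pi> $ y * K $ y $ x) \<and> (\<forall>x. (\<Sum>y\<in>UNIV. K $ x $ y) = 1)"

definition mean_zero :: "real^'a \<Rightarrow> real^'a \<Rightarrow> bool" where
  "mean_zero \<pi> f \<longleftrightarrow> (\<Sum>x\<in>UNIV. f $ x * \<pi> $ x) = 0"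

lemma inner_pi_expand:
  "inner_pi \<pi> (K *v f) g = (\<Sum>x\<in>UNIV. \<Sum>y\<in>UNIV. \<pi> $ x * K $ x $ y * f $ y * g $ x)"
  by (simp add: inner_pi_def matrix_vector_mult_def sum_distrib_left sum_distrib_right mult_ac)

lemma inner_pi_nonneg: "(\<And>x. 0 < \<pi> $ x) \<Longrightarrow> 0 \<le> inner_pi \<pi> f f"
  unfolding inner_pi_def by (intro sum_nonneg) (simp add: less_imp_le)

lemma inner_pi_eq_0_iff:
  assumes "\<And>x. 0 < \<pi> $ x"
  shows "inner_pi \<pi> f f = 0 \<longleftrightarrow> f = 0"
proof -
  have "inner_pi \<pi> f f = 0 \<longleftrightarrow> (\<forall>x\<in>UNIV. f $ x * f $ x * \<pi> $ x = 0)"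
    unfolding inner_pi_def using assms
    by (intro sum_nonneg_eq_0_iff) (simp_all add: less_imp_le)
  then show ?thesis
    using assms by (auto simp: vec_eq_iff less_imp_neq[symmetric])
qed

lemma inner_pi_bilinear:
  "inner_pi \<pi> (f + g) h = inner_pi \<pi> f h + inner_pi \<pi> g h"
  "inner_pi \<pi> h (f + g) = inner_pi \<pi> h f + inner_pi \<pi> h g"
  "inner_pi \<pi> (f - g) h = inner_pi \<pi> f h - inner_pi \<pi> g h"
  "inner_pi \<pi> h (f - g) = inner_pi \<pi> h f - inner_pi \<pi> h g"
  "inner_pi \<pi> (c *\<^sub>R f) h = c * inner_pi \<pi> f h"
  "inner_pi \<pi> h (c *\<^sub>R f) = c * inner_pi \<pi> h f"
  by (simp_all add: inner_pi_def algebra_simps sum.distrib sum_subtractf sum_distrib_left)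

lemma inner_pi_commute: "inner_pi \<pi> f g = inner_pi \<pi> g f"
  by (simp add: inner_pi_def mult.commute)

lemma reversible_self_adjoint:
  assumes "reversible_kernel \<pi> K"
  shows "inner_pi \<pi> (K *v f) g = inner_pi \<pi> (K *v g) f"
proof -
  have "inner_pi \<pi> (K *v f) g = (\<Sum>y\<in>UNIV. \<Sum>x\<in>UNIV. \<pi> $ x * K $ x $ y * f $ y * g $ x)"
    unfolding inner_pi_expand by (rule sum.swap)
  also have "\<dots> = (\<Sum>y\<in>UNIV. \<Sum>x\<in>UNIV. \<pi> $ y * K $ y $ x * g $ x * f $ y)"
    using assms by (intro sum.cong refl) (simp add: reversible_kernel_def)
  finally show ?thesis
    by (simp add: inner_pi_expand)
qed

lemma reversible_mean_zero:
  assumes "reversible_kernel \<pi> K" "mean_zero \<pi> f"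
  shows "mean_zero \<pi> (K *v f)"
proof -
  have one: "K *v 1 = 1"
    using assms(1) by (simp add: vec_eq_iff matrix_vector_mult_def reversible_kernel_def)
  have "(\<Sum>x\<in>UNIV. (K *v f) $ x * \<pi> $ x) = inner_pi \<pi> (K *v f) 1"
    by (simp add: inner_pi_def)
  also have "\<dots> = inner_pi \<pi> 1 f"
    by (simp add: reversible_self_adjoint[OF assms(1), of f] one)
  also have "\<dots> = 0"
    using assms(2) by (simp add: inner_pi_def mean_zero_def)
  finally show ?thesis
    by (simp add: mean_zero_def)
qed

lemma quadratic_form_Dirichlet:
  assumes "reversible_kernel \<pi> K"
  shows "inner_pi \<pi> (K *v f) f = inner_pi \<pi> f f
      - (\<Sum>x\<in>UNIV. \<Sum>y\<in>UNIV. \<pi> $ x * K $ x $ y * (f $ x - f $ y)\<^sup>2) / 2"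
proof -
  have a: "(\<Sum>x\<in>UNIV. \<Sum>y\<in>UNIV. \<pi> $ x * K $ x $ y * (f $ x)\<^sup>2) = inner_pi \<pi> f f"
  proof -
    have "(\<Sum>y\<in>UNIV. \<pi> $ x * K $ x $ y * (f $ x)\<^sup>2) = f $ x * f $ x * \<pi> $ x" for x
    proof -
      have "(\<Sum>y\<in>UNIV. \<pi> $ x * K $ x $ y * (f $ x)\<^sup>2) = \<pi> $ x * (\<Sum>y\<in>UNIV. K $ x $ y) * (f $ x)\<^sup>2"
        by (simp add: sum_distrib_left sum_distrib_right)
      then show ?thesis
        using assms by (simp add: reversible_kernel_def power2_eq_square)
    qed
    then show ?thesis
      by (simp add: inner_pi_def)
  qed
  have b: "(\<Sum>x\<in>UNIV. \<Sum>y\<in>UNIV. \<pi> $ x * K $ x $ y * (f $ y)\<^sup>2) = inner_pi \<pi> f f"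
  proof -
    have "(\<Sum>x\<in>UNIV. \<Sum>y\<in>UNIV. \<pi> $ x * K $ x $ y * (f $ y)\<^sup>2)
        = (\<Sum>y\<in>UNIV. \<Sum>x\<in>UNIV. \<pi> $ x * K $ x $ y * (f $ y)\<^sup>2)"
      by (rule sum.swap)
    also have "\<dots> = (\<Sum>y\<in>UNIV. \<Sum>x\<in>UNIV. \<pi> $ y * K $ y $ x * (f $ y)\<^sup>2)"
      using assms by (intro sum.cong refl) (simp add: reversible_kernel_def)
    finally show ?thesis
      by (simp add: a)
  qed
  have "(\<Sum>x\<in>UNIV. \<Sum>y\<in>UNIV. \<pi> $ x * K $ x $ y * (f $ x - f $ y)\<^sup>2)
      = (\<Sum>x\<in>UNIV. \<Sum>y\<in>UNIV. \<pi> $ x * K $ x $ y * (f $ x)\<^sup>2 + \<pi> $ x * K $ x $ y * (f $ y)\<^sup>2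
          - 2 * (\<pi> $ x * K $ x $ y * f $ y * f $ x))"
    by (intro sum.cong refl) (simp add: power2_eq_square algebra_simps)
  also have "\<dots> = 2 * inner_pi \<pi> f f - 2 * inner_pi \<pi> (K *v f) f"
    by (simp add: sum.distrib sum_subtractf a b inner_pi_expand sum_distrib_left[symmetric])
  finally show ?thesis
    by (simp add: diff_divide_distrib)
qed

text \<open>
  This is the ordering of Peskun: in the Dirichlet form only off-diagonal entries appear, each with
  a nonnegative square as its factor.
\<close>

lemma quadratic_form_antimono:
  assumes "reversible_kernel \<pi> K" "reversible_kernel \<pi> L" "\<And>x. 0 < \<pi> $ x"
    and "\<And>x y. x \<noteq> y \<Longrightarrow> K $ x $ y \<le> L $ x $ y"
  shows "inner_pi \<pi> (L *v f) f \<le> inner_pi \<pi> (K *v f) f"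
proof -
  have "(\<Sum>x\<in>UNIV. \<Sum>y\<in>UNIV. \<pi> $ x * K $ x $ y * (f $ x - f $ y)\<^sup>2)
      \<le> (\<Sum>x\<in>UNIV. \<Sum>y\<in>UNIV. \<pi> $ x * L $ x $ y * (f $ x - f $ y)\<^sup>2)"
  proof (intro sum_mono)
    fix x y
    show "\<pi> $ x * K $ x $ y * (f $ x - f $ y)\<^sup>2 \<le> \<pi> $ x * L $ x $ y * (f $ x - f $ y)\<^sup>2"
      using assms(3)[of x] assms(4)[of x y]
      by (cases "x = y") (auto intro!: mult_right_mono mult_left_mono)
  qed
  then show ?thesis
    by (simp add: quadratic_form_Dirichlet[OF assms(1)] quadratic_form_Dirichlet[OF assms(2)])
qed

text \<open>
  By polarisation \<open>4 \<langle>Kf, g\<rangle> = \<langle>K(f+g), f+g\<rangle> - \<langle>K(f-g), f-g\<rangle> \<le> 2 b (\<parallel>f\<parallel>\<^sup>2 + \<parallel>g\<parallel>\<^sup>2)\<close>. Self-adjointness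
  enters here, and the choice \<open>g = Kf / b\<close> turns the inequality into the bound on the norm.
\<close>

lemma reversible_contraction:
  assumes K: "reversible_kernel \<pi> K" and "0 \<le> b"
    and bound: "\<And>f. mean_zero \<pi> f \<Longrightarrow> \<bar>inner_pi \<pi> (K *v f) f\<bar> \<le> b * inner_pi \<pi> f f"
    and f: "mean_zero \<pi> f"
  shows "inner_pi \<pi> (K *v f) (K *v f) \<le> b\<^sup>2 * inner_pi \<pi> f f"
proof -
  let ?N = "inner_pi \<pi> (K *v f) (K *v f)"
  have key: "2 * inner_pi \<pi> (K *v f) g \<le> b * (inner_pi \<pi> f f + inner_pi \<pi> g g)"
    if g: "mean_zero \<pi> g" for g
  proof -
    have "mean_zero \<pi> (f + g)" "mean_zero \<pi> (f - g)"
      using f g by (simp_all add: mean_zero_def algebra_simps sum.distrib sum_subtractf)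
    from bound[OF this(1)] bound[OF this(2)]
    have "inner_pi \<pi> (K *v (f + g)) (f + g) - inner_pi \<pi> (K *v (f - g)) (f - g)
        \<le> b * inner_pi \<pi> (f + g) (f + g) + b * inner_pi \<pi> (f - g) (f - g)"
      by linarith
    then show ?thesis
      using reversible_self_adjoint[OF K, of g f] inner_pi_commute[of \<pi> f g]
      by (simp add: matrix_vector_right_distrib matrix_vector_mult_diff_distrib inner_pi_bilinear
          algebra_simps)
  qed
  have scaled: "mean_zero \<pi> (t *\<^sub>R (K *v f))" for t
    using reversible_mean_zero[OF K f]
    by (simp add: mean_zero_def mult.assoc sum_distrib_left[symmetric])
  show ?thesis
  proof (cases "b = 0")
    case True
    then show ?thesis
      using key[OF scaled[of 1]] by simp
  next
    case False
    then have b: "b > 0"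
      using assms(2) by simp
    have "2 * (?N / b) \<le> b * (inner_pi \<pi> f f + ?N / b\<^sup>2)"
      using key[OF scaled[of "1 / b"]] by (simp add: inner_pi_bilinear power2_eq_square)
    then have "?N / b \<le> b * inner_pi \<pi> f f"
      using b by (simp add: field_simps power2_eq_square)
    then show ?thesis
      using b by (simp add: field_simps power2_eq_square)
  qed
qed

text \<open>
  The function \<open>f = \<delta>\<^sub>x/\<pi>(x) - 1\<close> has mean zero and \<open>\<parallel>f\<parallel>\<^sup>2 = 1/\<pi>(x) - 1\<close>, while detailed balance gives
  \<open>(Kf)(y) = K(x,y)/\<pi>(y) - 1\<close>, whose squared norm is the chi-square divergence.
\<close>

lemma reversible_chi_square_le:
  assumes K: "reversible_kernel \<pi> K" and pos: "\<And>x. 0 < \<pi> $ x" and "prob_vec \<pi>" and "0 \<le> b"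
    and bound: "\<And>f. mean_zero \<pi> f \<Longrightarrow> \<bar>inner_pi \<pi> (K *v f) f\<bar> \<le> b * inner_pi \<pi> f f"
  shows "chi_square (K $ x) \<pi> \<le> b\<^sup>2 * (1 / \<pi> $ x - 1)"
proof -
  define f :: "real^'a" where "f = (\<chi> z. (if z = x then 1 / \<pi> $ x else 0) - 1)"
  have px: "\<pi> $ x \<noteq> 0" and py: "\<pi> $ y \<noteq> 0" for y
    using pos by (auto simp: less_imp_neq[symmetric])
  have tot: "(\<Sum>z\<in>UNIV. \<pi> $ z) = 1"
    using assms(3) by (simp add: prob_vec_def)
  have "f $ z * \<pi> $ z = (if z = x then 1 else 0) - \<pi> $ z" for z
    using px by (auto simp: f_def algebra_simps)
  then have mz: "mean_zero \<pi> f"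
    by (simp add: mean_zero_def sum_subtractf tot)
  have "f $ z * f $ z * \<pi> $ z = (if z = x then 1 / \<pi> $ x - 2 else 0) + \<pi> $ z" for z
    using px by (auto simp: f_def field_simps)
  then have ff: "inner_pi \<pi> f f = 1 / \<pi> $ x - 1"
    by (simp add: inner_pi_def sum.distrib tot)
  have Kf: "(K *v f) $ y = K $ x $ y / \<pi> $ y - 1" for y
  proof -
    have "(K *v f) $ y = (\<Sum>z\<in>UNIV. (if z = x then K $ y $ x / \<pi> $ x else 0) - K $ y $ z)"
      unfolding matrix_vector_mult_def f_def vec_lambda_beta
      by (intro sum.cong) (auto simp: algebra_simps)
    also have "\<dots> = K $ y $ x / \<pi> $ x - 1"
      using K by (simp add: sum_subtractf reversible_kernel_def)
    also have "K $ y $ x / \<pi> $ x = K $ x $ y / \<pi> $ y"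
    proof -
      have "\<pi> $ x * K $ x $ y = \<pi> $ y * K $ y $ x"
        using K by (simp add: reversible_kernel_def)
      then show ?thesis
        using px py[of y] by (simp add: field_simps)
    qed
    finally show ?thesis .
  qed
  have "chi_square (K $ x) \<pi> = inner_pi \<pi> (K *v f) (K *v f)"
    unfolding chi_square_def inner_pi_def Kf
    by (intro sum.cong refl) (use py in \<open>simp add: field_simps power2_eq_square\<close>)
  then show ?thesis
    using reversible_contraction[OF K assms(4) bound mz] by (simp add: ff)
qed

section \<open>The extreme Rayleigh quotients\<close>

text \<open>
  An unbounded supremum or infimum of reals would be an arbitrary number, so boundedness
  on the unit sphere has to be established before the definitions of \<open>lambda_sup\<close> and
  \<open>lambda_inf\<close> yield anything.
\<close>

lemma quadratic_form_bounded:
  assumes pos: "\<And>x. 0 < \<pi> $ x"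
  obtains B where "\<And>f. f \<in> test_functions \<pi> \<Longrightarrow> \<bar>inner_pi \<pi> (K *v f) f\<bar> \<le> B"
proof
  fix f assume f: "f \<in> test_functions \<pi>"
  then have n1: "inner_pi \<pi> f f = 1"
    by (simp add: test_functions_def norm_pi_def)
  have sq: "(f $ x)\<^sup>2 \<le> 1 / \<pi> $ x" for x
  proof -
    have "f $ x * f $ x * \<pi> $ x \<le> inner_pi \<pi> f f"
      unfolding inner_pi_def using pos
      by (intro member_le_sum[where f = "\<lambda>x. f $ x * f $ x * \<pi> $ x"]) (simp_all add: less_imp_le)
    then show ?thesis
      using pos[of x] n1 by (simp add: field_simps power2_eq_square)
  qed
  have prd: "\<bar>f $ y * f $ x\<bar> \<le> 1 / \<pi> $ x + 1 / \<pi> $ y" for x y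
  proof -
    have "2 * \<bar>f $ y * f $ x\<bar> \<le> (f $ x)\<^sup>2 + (f $ y)\<^sup>2"
      using sum_squares_bound[of "\<bar>f $ x\<bar>" "\<bar>f $ y\<bar>"] by (simp add: abs_mult mult_ac)
    then show ?thesis
      using sq[of x] sq[of y] by linarith
  qed
  have "\<bar>inner_pi \<pi> (K *v f) f\<bar> \<le> (\<Sum>x\<in>UNIV. \<Sum>y\<in>UNIV. \<bar>\<pi> $ x * K $ x $ y * f $ y * f $ x\<bar>)"
    unfolding inner_pi_expand by (intro order_trans[OF sum_abs] sum_mono sum_abs)
  also have "\<dots> \<le> (\<Sum>x\<in>UNIV. \<Sum>y\<in>UNIV. \<bar>\<pi> $ x * K $ x $ y\<bar> * (1 / \<pi> $ x + 1 / \<pi> $ y))"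
  proof (intro sum_mono)
    fix x y
    have "\<bar>\<pi> $ x * K $ x $ y * f $ y * f $ x\<bar> = \<bar>\<pi> $ x * K $ x $ y\<bar> * \<bar>f $ y * f $ x\<bar>"
      by (simp add: abs_mult)
    also have "\<dots> \<le> \<bar>\<pi> $ x * K $ x $ y\<bar> * (1 / \<pi> $ x + 1 / \<pi> $ y)"
      by (intro mult_left_mono prd) simp
    finally show "\<bar>\<pi> $ x * K $ x $ y * f $ y * f $ x\<bar>
        \<le> \<bar>\<pi> $ x * K $ x $ y\<bar> * (1 / \<pi> $ x + 1 / \<pi> $ y)" .
  qed
  finally show "\<bar>inner_pi \<pi> (K *v f) f\<bar>
      \<le> (\<Sum>x\<in>UNIV. \<Sum>y\<in>UNIV. \<bar>\<pi> $ x * K $ x $ y\<bar> * (1 / \<pi> $ x + 1 / \<pi> $ y))" .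
qed

text \<open>
  Both bounds are homogeneous, hence also meaningful for \<open>f = 0\<close>. In particular they are true,
  and vacuous, on a one-point space, where no test function exists.
\<close>

lemma lambda_bounds:
  assumes pos: "\<And>x. 0 < \<pi> $ x" and f: "mean_zero \<pi> f"
  shows "inner_pi \<pi> (K *v f) f \<le> lambda_sup \<pi> K * inner_pi \<pi> f f"
    and "lambda_inf \<pi> K * inner_pi \<pi> f f \<le> inner_pi \<pi> (K *v f) f"
proof -
  let ?q = "inner_pi \<pi> f f"
  have "inner_pi \<pi> (K *v f) f \<le> lambda_sup \<pi> K * ?q \<and> lambda_inf \<pi> K * ?q \<le> inner_pi \<pi> (K *v f) f"
  proof (cases "f = 0")
    case True
    then show ?thesis
      by (simp add: inner_pi_def)
  next
    case False
    then have q: "?q > 0"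
      using inner_pi_nonneg[of \<pi> f, OF pos] inner_pi_eq_0_iff[of \<pi> f, OF pos]
      by (simp add: order_less_le)
    define g where "g = (1 / sqrt ?q) *\<^sub>R f"
    have "inner_pi \<pi> g g = 1"
      using q by (simp add: g_def inner_pi_bilinear)
    moreover have "(\<Sum>x\<in>UNIV. g $ x * \<pi> $ x) = (1 / sqrt ?q) * (\<Sum>x\<in>UNIV. f $ x * \<pi> $ x)"
      by (simp add: g_def sum_distrib_left)
    ultimately have g: "g \<in> test_functions \<pi>"
      using f by (simp add: test_functions_def norm_pi_def mean_zero_def)
    have form: "inner_pi \<pi> (K *v g) g = inner_pi \<pi> (K *v f) f / ?q"
      using q by (simp add: g_def inner_pi_bilinear matrix_vector_mult_scaleR)
    obtain B where B: "\<And>h. h \<in> test_functions \<pi> \<Longrightarrow> \<bar>inner_pi \<pi> (K *v h) h\<bar> \<le> B"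
      using quadratic_form_bounded[of \<pi> K, OF pos] by blast
    have "bdd_above ((\<lambda>h. inner_pi \<pi> (K *v h) h) ` test_functions \<pi>)"
      using B by (intro bdd_aboveI[of _ B]) (auto simp: abs_le_iff)
    then have up: "inner_pi \<pi> (K *v g) g \<le> lambda_sup \<pi> K"
      unfolding lambda_sup_def by (rule cSUP_upper[OF g])
    have "bdd_below ((\<lambda>h. inner_pi \<pi> (K *v h) h) ` test_functions \<pi>)"
      using B by (intro bdd_belowI[of _ "- B"]) (force simp: abs_le_iff)
    then have lo: "lambda_inf \<pi> K \<le> inner_pi \<pi> (K *v g) g"
      unfolding lambda_inf_def by (rule cINF_lower[OF _ g])
    show ?thesis
      using up lo q by (simp add: form field_simps)
  qed
  then show "inner_pi \<pi> (K *v f) f \<le> lambda_sup \<pi> K * ?q"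
    and "lambda_inf \<pi> K * ?q \<le> inner_pi \<pi> (K *v f) f"
    by simp_all
qed

section \<open>The Metropolis-Hastings kernels\<close>

lemma time_reversal_balance:
  assumes "\<And>x. 0 < \<pi> $ x"
  shows "\<pi> $ x * time_reversal \<pi> R $ x $ y = \<pi> $ y * R $ y $ x"
  using assms[of x] by (simp add: time_reversal_def)

lemma time_reversal_row_sum:
  assumes "\<And>x. 0 < \<pi> $ x" "stationary R \<pi>"
  shows "(\<Sum>y\<in>UNIV. time_reversal \<pi> R $ x $ y) = 1"
  using assms(1)[of x] stationary_entry[OF assms(2), of x]
  by (simp add: time_reversal_def sum_divide_distrib[symmetric])

lemma MH1_reversible:
  assumes "\<And>x. 0 < \<pi> $ x" "stochastic R"
  shows "reversible_kernel \<pi> (MH1 \<pi> R)"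
proof -
  let ?S = "time_reversal \<pi> R"
  have scale: "\<pi> $ x * min (R $ x $ y) (?S $ x $ y) = min (\<pi> $ x * R $ x $ y) (\<pi> $ y * R $ y $ x)" for x y
    using assms(1)[of x] time_reversal_balance[of \<pi> x R y, OF assms(1)]
    by (simp add: min_mult_distrib_left)
  have "(\<Sum>y\<in>UNIV. MH1 \<pi> R $ x $ y) = 1" for x
  proof -
    have "(\<Sum>y\<in>UNIV. MH1 \<pi> R $ x $ y)
        = R $ x $ x + MH_rho \<pi> R x + (\<Sum>y\<in>UNIV - {x}. min (R $ x $ y) (?S $ x $ y))"
      by (simp add: sum.remove[of UNIV x] MH1_def)
    also have "\<dots> = R $ x $ x + (\<Sum>y\<in>UNIV - {x}. R $ x $ y)"
      by (simp add: MH_rho_def sum_subtractf)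
    also have "\<dots> = (\<Sum>y\<in>UNIV. R $ x $ y)"
      by (simp add: sum.remove[of UNIV x])
    finally show ?thesis
      using assms(2) by (simp add: stochastic_def prob_vec_def)
  qed
  then show ?thesis
    by (simp add: reversible_kernel_def MH1_def scale min.commute)
qed

text \<open>
  The row sums use \<open>max(u,v) = u + v - min(u,v)\<close> and stationarity, by which the rows of the time
  reversal sum to one as well.
\<close>

lemma MH2_reversible:
  assumes "\<And>x. 0 < \<pi> $ x" "stochastic R" "stationary R \<pi>"
  shows "reversible_kernel \<pi> (MH2 \<pi> R)"
proof -
  let ?S = "time_reversal \<pi> R"
  have scale: "\<pi> $ x * max (R $ x $ y) (?S $ x $ y) = max (\<pi> $ x * R $ x $ y) (\<pi> $ y * R $ y $ x)" for x y
    using assms(1)[of x] time_reversal_balance[of \<pi> x R y, OF assms(1)]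
    by (simp add: max_mult_distrib_left)
  have "(\<Sum>y\<in>UNIV. MH2 \<pi> R $ x $ y) = 1" for x
  proof -
    have diag: "?S $ x $ x = R $ x $ x"
      using assms(1)[of x] by (simp add: time_reversal_def)
    have "(\<Sum>y\<in>UNIV. MH2 \<pi> R $ x $ y)
        = R $ x $ x - MH_rho \<pi> R x + (\<Sum>y\<in>UNIV - {x}. max (R $ x $ y) (?S $ x $ y))"
      by (simp add: sum.remove[of UNIV x] MH2_def)
    also have "(\<Sum>y\<in>UNIV - {x}. max (R $ x $ y) (?S $ x $ y))
        = (\<Sum>y\<in>UNIV - {x}. ?S $ x $ y + (R $ x $ y - min (R $ x $ y) (?S $ x $ y)))"
      by (intro sum.cong) (auto simp: max_def min_def)
    also have "\<dots> = (\<Sum>y\<in>UNIV - {x}. ?S $ x $ y) + MH_rho \<pi> R x"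
      by (simp add: MH_rho_def sum.distrib)
    also have "R $ x $ x - MH_rho \<pi> R x + \<dots> = (\<Sum>y\<in>UNIV. ?S $ x $ y)"
      by (simp add: sum.remove[of UNIV x] diag)
    finally show ?thesis
      using time_reversal_row_sum[of \<pi> R, OF assms(1,3)] by simp
  qed
  then show ?thesis
    by (simp add: reversible_kernel_def MH2_def scale max.commute)
qed

text \<open>
  Each entry of \<open>R\<close> lies between those of the two kernels (in the opposite order on the diagonal),
  so its squared deviation from \<open>\<pi>\<close> is at most the larger of theirs.
\<close>

lemma chi_square_le_MH_sum:
  assumes "\<And>x. 0 < \<pi> $ x"
  shows "chi_square (R $ x) \<pi> \<le> chi_square (MH1 \<pi> R $ x) \<pi> + chi_square (MH2 \<pi> R $ x) \<pi>"
  unfolding chi_square_def sum.distrib[symmetric]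
proof (rule sum_mono)
  fix y
  have between: "(r - c)\<^sup>2 \<le> (u - c)\<^sup>2 + (v - c)\<^sup>2" if "u \<le> r" "r \<le> v" for r u v c :: real
  proof (cases "r \<le> c")
    case True
    then have "(r - c)\<^sup>2 \<le> (u - c)\<^sup>2"
      using that by (intro abs_le_square_iff[THEN iffD1]) simp
    then show ?thesis
      by (simp add: add_increasing2)
  next
    case False
    then have "(r - c)\<^sup>2 \<le> (v - c)\<^sup>2"
      using that by (intro abs_le_square_iff[THEN iffD1]) simp
    then show ?thesis
      by (simp add: add_increasing)
  qed
  have "0 \<le> MH_rho \<pi> R x"
    unfolding MH_rho_def by (intro sum_nonneg) simp
  then have "(R $ x $ y - \<pi> $ y)\<^sup>2 \<le> (MH1 \<pi> R $ x $ y - \<pi> $ y)\<^sup>2 + (MH2 \<pi> R $ x $ y - \<pi> $ y)\<^sup>2"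
    using between[of "MH2 \<pi> R $ x $ y" "R $ x $ y" "MH1 \<pi> R $ x $ y" "\<pi> $ y"]
      between[of "MH1 \<pi> R $ x $ y" "R $ x $ y" "MH2 \<pi> R $ x $ y" "\<pi> $ y"]
    by (cases "x = y") (auto simp: MH1_def MH2_def add.commute)
  then show "(R $ x $ y - \<pi> $ y)\<^sup>2 / \<pi> $ y
      \<le> (MH1 \<pi> R $ x $ y - \<pi> $ y)\<^sup>2 / \<pi> $ y + (MH2 \<pi> R $ x $ y - \<pi> $ y)\<^sup>2 / \<pi> $ y"
    using assms[of y] by (simp add: add_divide_distrib[symmetric] divide_right_mono)
qed

lemma MH_forms_bounded:
  assumes pos: "\<And>x. 0 < \<pi> $ x" and R: "stochastic R" "stationary R \<pi>"
    and lo: "- b \<le> lambda_inf \<pi> (MH2 \<pi> R)" and up: "lambda_sup \<pi> (MH1 \<pi> R) \<le> b"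
    and f: "mean_zero \<pi> f"
  shows "\<bar>inner_pi \<pi> (MH1 \<pi> R *v f) f\<bar> \<le> b * inner_pi \<pi> f f"
    and "\<bar>inner_pi \<pi> (MH2 \<pi> R *v f) f\<bar> \<le> b * inner_pi \<pi> f f"
proof -
  note nn = inner_pi_nonneg[of \<pi> f, OF pos]
  have "inner_pi \<pi> (MH1 \<pi> R *v f) f \<le> b * inner_pi \<pi> f f"
    using lambda_bounds(1)[of \<pi> f "MH1 \<pi> R", OF pos f] mult_right_mono[OF up nn] by linarith
  moreover have "- (b * inner_pi \<pi> f f) \<le> inner_pi \<pi> (MH2 \<pi> R *v f) f"
    using lambda_bounds(2)[of \<pi> f "MH2 \<pi> R", OF pos f] mult_right_mono[OF lo nn] by simp
  moreover have "inner_pi \<pi> (MH2 \<pi> R *v f) f \<le> inner_pi \<pi> (MH1 \<pi> R *v f) f"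
    using MH1_reversible[of \<pi> R, OF pos R(1)] MH2_reversible[of \<pi> R, OF pos R] pos
    by (rule quadratic_form_antimono) (auto simp: MH1_def MH2_def)
  ultimately show "\<bar>inner_pi \<pi> (MH1 \<pi> R *v f) f\<bar> \<le> b * inner_pi \<pi> f f"
    and "\<bar>inner_pi \<pi> (MH2 \<pi> R *v f) f\<bar> \<le> b * inner_pi \<pi> f f"
    by (auto simp: abs_le_iff)
qed

lemma chi_square_le_of_MH_bounds:
  assumes pos: "\<And>x. 0 < \<pi> $ x" and R: "stochastic R" "stationary R \<pi>"
    and b: "0 \<le> b" "- b \<le> lambda_inf \<pi> (MH2 \<pi> R)" "lambda_sup \<pi> (MH1 \<pi> R) \<le> b"
  shows "chi_square (R $ x) \<pi> \<le> 2 * b\<^sup>2 * (1 / \<pi> $ x - 1)"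
proof -
  have pv: "prob_vec \<pi>"
    using R(2) by (simp add: stationary_def)
  have "chi_square (MH1 \<pi> R $ x) \<pi> \<le> b\<^sup>2 * (1 / \<pi> $ x - 1)"
    using MH_forms_bounded(1)[of \<pi> R b, OF pos R b(2,3)]
    by (intro reversible_chi_square_le MH1_reversible pos R pv b)
  moreover have "chi_square (MH2 \<pi> R $ x) \<pi> \<le> b\<^sup>2 * (1 / \<pi> $ x - 1)"
    using MH_forms_bounded(2)[of \<pi> R b, OF pos R b(2,3)]
    by (intro reversible_chi_square_le MH2_reversible pos R pv b)
  ultimately show ?thesis
    using chi_square_le_MH_sum[of \<pi> R x, OF pos] by linarith
qed

section \<open>The gap and the mixing time\<close>

text \<open>
  The families in the definition of \<open>\<beta>\<close> are bounded because on \<open>\<C>\<close> both quantities are below one,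
  so \<open>\<beta>\<close> is a true supremum. A negative \<open>\<Lambda>(M\<^sub>1(P\<^sup>n))\<close> is not listed there, but it is bounded by
  \<open>0 \<le> \<beta>\<^sup>n\<close>.
\<close>

lemma MH_beta_bounds:
  assumes n: "n \<in> MH_C P \<pi>"
  shows "0 \<le> MH_beta P \<pi>"
    and "- (MH_beta P \<pi> ^ n) \<le> lambda_inf \<pi> (MH2 \<pi> (kpow P n))"
    and "lambda_sup \<pi> (MH1 \<pi> (kpow P n)) \<le> MH_beta P \<pi> ^ n"
proof -
  let ?l = "\<lambda>n. \<bar>lambda_inf \<pi> (MH2 \<pi> (kpow P n))\<bar>"
  let ?L = "\<lambda>n. lambda_sup \<pi> (MH1 \<pi> (kpow P n))"
  let ?A = "{root n (?l n) | n. n \<in> MH_C P \<pi>} \<union> {root n (?L n) | n. n \<in> MH_C P \<pi> \<and> 0 \<le> ?L n}"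
  have beta: "MH_beta P \<pi> = Sup ?A"
    using n by (auto simp: MH_beta_def)
  have "root k (?l k) \<le> 1" "root k (?L k) \<le> 1" if "k \<in> MH_C P \<pi>" for k
    using that by (auto simp: MH_C_def real_root_le_1_iff)
  then have bdd: "bdd_above ?A"
    by (intro bdd_aboveI[of _ 1]) blast
  have n1: "n > 0"
    using n by (simp add: MH_C_def)
  have rl: "root n (?l n) \<le> MH_beta P \<pi>"
    unfolding beta using n by (intro cSup_upper bdd) blast
  moreover have rl0: "0 \<le> root n (?l n)"
    using n1 by (simp add: real_root_ge_0_iff)
  ultimately show b0: "0 \<le> MH_beta P \<pi>"
    by linarith
  have "?l n = root n (?l n) ^ n"
    using n1 by simp
  also have "\<dots> \<le> MH_beta P \<pi> ^ n"
    using rl rl0 by (rule power_mono)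
  finally show "- (MH_beta P \<pi> ^ n) \<le> lambda_inf \<pi> (MH2 \<pi> (kpow P n))"
    by (simp add: abs_le_iff)
  show "?L n \<le> MH_beta P \<pi> ^ n"
  proof (cases "0 \<le> ?L n")
    case True
    have "root n (?L n) \<le> MH_beta P \<pi>"
      unfolding beta using n True by (intro cSup_upper bdd) blast
    then have "root n (?L n) ^ n \<le> MH_beta P \<pi> ^ n"
      using True n1 by (intro power_mono) auto
    then show ?thesis
      using True n1 by simp
  next
    case False
    moreover have "0 \<le> MH_beta P \<pi> ^ n"
      using b0 by simp
    ultimately show ?thesis
      by linarith
  qed
qed

lemma t_mix_le:
  assumes "\<And>x. tv_dist (kpow P n $ x) \<pi> \<le> \<epsilon>"
  shows "t_mix P \<pi> \<epsilon> \<le> enat n"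
proof -
  have "mix_dist P \<pi> n \<le> \<epsilon>"
    unfolding mix_dist_def using assms by (intro cSUP_least) auto
  then show ?thesis
    unfolding t_mix_def by (intro INF_lower) simp
qed

text \<open>
  The numerical core for \<open>k = \<lfloor>L/\<gamma>\<rfloor>\<close>: rounding down costs a factor \<open>e\<close>, and
  \<open>m\<^sup>2 (1/p - 1) \<le> m (1 - m) \<le> 1/4\<close> together with \<open>e\<^sup>2 < 8\<close> pays for it.
\<close>

lemma rounded_chi_square_bound:
  fixes m \<epsilon> \<gamma> p :: real
  assumes m: "0 < m" "m \<le> p" and "0 < \<epsilon>" and \<gamma>: "0 < \<gamma>" "\<gamma> \<le> 1"
    and k: "ln (1 / (\<epsilon> * m)) / \<gamma> - 1 \<le> real k"
  shows "2 * ((1 - \<gamma>) ^ k)\<^sup>2 * (1 / p - 1) \<le> (2 * \<epsilon>)\<^sup>2"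
proof -
  have em: "\<epsilon> * m > 0"
    using assms by simp
  have "1 - \<gamma> \<le> exp (- \<gamma>)"
    using exp_ge_add_one_self[of "- \<gamma>"] by simp
  then have "(1 - \<gamma>) ^ k \<le> exp (- \<gamma>) ^ k"
    using \<gamma> by (intro power_mono) auto
  also have "\<dots> = exp (- (\<gamma> * real k))"
    by (simp add: exp_of_nat_mult[symmetric] mult.commute)
  also have "\<dots> \<le> exp (1 - ln (1 / (\<epsilon> * m)))"
  proof -
    have "ln (1 / (\<epsilon> * m)) - \<gamma> \<le> \<gamma> * real k"
      using mult_left_mono[OF k, of \<gamma>] \<gamma> by (simp add: right_diff_distrib)
    then show ?thesis
      using \<gamma> by simp
  qed
  also have "\<dots> = exp 1 * (\<epsilon> * m)"
    using em assms(3) m by (simp add: exp_diff)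
  finally have "((1 - \<gamma>) ^ k)\<^sup>2 \<le> (exp 1 * (\<epsilon> * m))\<^sup>2"
    using \<gamma> by (intro power_mono) auto
  also have "\<dots> = (exp 1)\<^sup>2 * (\<epsilon> * m)\<^sup>2"
    by (simp add: power_mult_distrib)
  also have "\<dots> \<le> 8 * (\<epsilon> * m)\<^sup>2"
  proof (rule mult_right_mono)
    have "(exp 1)\<^sup>2 \<le> (272 / 100 :: real)\<^sup>2"
      using e_less_272 by (intro power_mono) auto
    then show "(exp (1::real))\<^sup>2 \<le> 8"
      by (simp add: power2_eq_square)
  qed simp
  finally have pw: "((1 - \<gamma>) ^ k)\<^sup>2 \<le> 8 * (\<epsilon> * m)\<^sup>2" .
  show ?thesis
  proof (cases "1 / p - 1 \<le> 0")
    case True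
    then have "2 * ((1 - \<gamma>) ^ k)\<^sup>2 * (1 / p - 1) \<le> 0"
      by (intro mult_nonneg_nonpos) auto
    then show ?thesis
      using order_trans zero_le_power2 by blast
  next
    case False
    have "2 * ((1 - \<gamma>) ^ k)\<^sup>2 * (1 / p - 1) \<le> 2 * (8 * (\<epsilon> * m)\<^sup>2) * (1 / p - 1)"
      using pw False by (intro mult_right_mono) auto
    also have "\<dots> \<le> 2 * (8 * (\<epsilon> * m)\<^sup>2) * (1 / m - 1)"
      using m by (intro mult_left_mono diff_right_mono divide_left_mono) auto
    also have "\<dots> = 16 * \<epsilon>\<^sup>2 * (m * (1 - m))"
      using m by (simp add: field_simps power2_eq_square)
    also have "\<dots> \<le> 16 * \<epsilon>\<^sup>2 * (1 / 4)"
    proof (rule mult_left_mono)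
      show "m * (1 - m) \<le> 1 / 4"
        using zero_le_power2[of "m - 1 / 2"] by (simp add: power2_eq_square algebra_simps)
    qed simp
    finally show ?thesis
      by (simp add: power2_eq_square)
  qed
qed

theorem corollary5p1:
  fixes P :: "real^'a^'a" and \<pi> :: "real^'a" and \<epsilon> :: real
  assumes "stochastic P"
    and "irreducible_kernel P"
    and "stationary P \<pi>"
    and "finite (MH_Cc P \<pi>)"
    and "MH_gap P \<pi> > 0"
    and "0 < \<epsilon>" and "\<epsilon> < 1"
  shows "ereal_of_enat (t_mix P \<pi> \<epsilon>)
           \<le> ereal (real (t_star P \<pi>) + ln (1 / (\<epsilon> * pi_min \<pi>)) / MH_gap P \<pi>)"
proof -
  define m \<gamma> L t where "m = pi_min \<pi>" and "\<gamma> = MH_gap P \<pi>"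
    and "L = ln (1 / (\<epsilon> * m))" and "t = t_star P \<pi>"
  define k where "k = nat \<lfloor>L / \<gamma>\<rfloor>"
  have pos: "0 < \<pi> $ x" for x
    using irreducible_stationary_pos[OF assms(1-3)] .
  have pv: "prob_vec \<pi>"
    using assms(3) by (simp add: stationary_def)
  have pvP: "prob_vec (kpow P n $ x)" for n x
    using stochastic_kpow[OF assms(1)] by (simp add: stochastic_def)
  have m_le: "m \<le> \<pi> $ x" for x
    unfolding m_def pi_min_def by (intro Min_le) auto
  have "m \<in> range (($) \<pi>)"
    unfolding m_def pi_min_def by (intro Min_in) auto
  then have m0: "0 < m"
    using pos by auto
  have m1: "m \<le> 1"
    using m_le order_trans member_le_sum[of undefined UNIV "($) \<pi>"] pv
    by (fastforce simp: prob_vec_def)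
  have \<gamma>0: "0 < \<gamma>"
    using assms(5) by (simp add: \<gamma>_def)
  have inC: "n \<in> MH_C P \<pi>" if "t < n" for n
  proof (rule ccontr)
    assume "n \<notin> MH_C P \<pi>"
    then have "n \<in> MH_Cc P \<pi>"
      using that by (simp add: MH_Cc_def)
    then have "n \<le> t"
      unfolding t_def t_star_def using assms(4) by auto
    then show False
      using that by simp
  qed
  have \<gamma>1: "\<gamma> \<le> 1"
    using MH_beta_bounds(1)[OF inC[OF lessI]] by (simp add: \<gamma>_def MH_gap_def)
  have em1: "\<epsilon> * m \<le> 1"
    using assms(6,7) m0 m1 by (simp add: mult_le_one)
  have L0: "0 \<le> L"
    unfolding L_def using em1 m0 assms(6) by (intro ln_ge_zero) simp
  have "0 \<le> L / \<gamma>"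
    using L0 \<gamma>0 by simp
  then have k_le: "real k \<le> L / \<gamma>" and k_gt: "L / \<gamma> - 1 < real k"
    unfolding k_def by linarith+
  have "tv_dist (kpow P (t + k) $ x) \<pi> \<le> \<epsilon>" for x
  proof (cases "k = 0")
    case True
    then have "L < 1"
      using \<gamma>0 \<gamma>1 k_gt by (simp add: field_simps)
    then have "1 / (\<epsilon> * m) < exp 1"
      using m0 assms(6) unfolding L_def by (metis exp_less_cancel_iff exp_ln zero_less_divide_1_iff mult_pos_pos)
    then have "1 / (\<epsilon> * m) < 4"
      using e_less_272 by simp
    then have "1 / 4 < \<epsilon> * m"
      using m0 assms(6) by (simp add: field_simps)
    moreover have "(1 - m) * m \<le> 1 / 4"
      using zero_le_power2[of "m - 1 / 2"] by (simp add: power2_eq_square algebra_simps)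
    ultimately have "(1 - m) * m \<le> \<epsilon> * m"
      by linarith
    then have "1 - m \<le> \<epsilon>"
      using m0 by simp
    then show ?thesis
      using tv_dist_le_one_minus[of "kpow P (t + k) $ x" \<pi> m, OF pvP pv m_le] by linarith
  next
    case False
    let ?n = "t + k"
    have n: "?n \<in> MH_C P \<pi>"
      using False by (intro inC) simp
    have beta: "MH_beta P \<pi> = 1 - \<gamma>"
      by (simp add: \<gamma>_def MH_gap_def)
    define b where "b = (1 - \<gamma>) ^ k"
    have pw: "MH_beta P \<pi> ^ ?n \<le> b"
      unfolding beta b_def using \<gamma>0 \<gamma>1 by (intro power_decreasing) auto
    have b0: "0 \<le> b"
      unfolding b_def using \<gamma>1 by simp
    have "- b \<le> lambda_inf \<pi> (MH2 \<pi> (kpow P ?n))" "lambda_sup \<pi> (MH1 \<pi> (kpow P ?n)) \<le> b"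
      using MH_beta_bounds(2,3)[OF n] pw by linarith+
    then have "chi_square (kpow P ?n $ x) \<pi> \<le> 2 * b\<^sup>2 * (1 / \<pi> $ x - 1)"
      by (intro chi_square_le_of_MH_bounds pos b0 stochastic_kpow stationary_kpow assms(1,3))
    also have "\<dots> \<le> (2 * \<epsilon>)\<^sup>2"
      unfolding b_def using k_gt assms(6) \<gamma>0 \<gamma>1 m0 m_le
      by (intro rounded_chi_square_bound[of m]) (auto simp: L_def)
    finally show ?thesis
      using assms(6) by (intro tv_dist_le_chi_square pos pvP pv) auto
  qed
  then have "ereal_of_enat (t_mix P \<pi> \<epsilon>) \<le> ereal_of_enat (enat (t + k))"
    by (simp only: ereal_of_enat_le_iff t_mix_le)
  also have "\<dots> \<le> ereal (real t + L / \<gamma>)"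
    using k_le by simp
  finally show ?thesis
    by (simp add: t_def L_def m_def \<gamma>_def)
qed

end
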